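(* Let $n,q\ge 1$ be integers, let $L>0$, let $Y=(Y_1,\dots,Y_n)$ be independent real random variables each of which is central moment bounded with the same parameter $L$, and let $f(y)=\sum_{h\in\mathcal H}w_h\prod_{v\in\mathcal V(h)}y_v$ be a multilinear polynomial of power $q$ with real coefficients $w_h$. Then $$\mathrm{Var}[f(Y)]\le 2q\,4^q\max_{r\in\{1,\dots,q\}}\left(\mu_0(f,Y)\,\mu_r(f,Y)\,4^rL^r\right).$$
   Context: A real random variable $Z$ is central moment bounded with parameter $L>0$ if for every integer $i\ge 1$, $\mathbb E[|Z-\mathbb E[Z]|^i]\le i\cdot L\cdot \mathbb E[|Z-\mathbb E[Z]|^{i-1}]$ (with $|\cdot|^0=1$; in particular $\mathbb E[Z]$ exists and is finite). Multilinear polynomials: $H=([n],\mathcal H)$ is a hypergraph on the vertex set $[n]=\{1,\dots,n\}$ whose hyperedges $h\in\mathcal H$ have pairwise distinct vertex sets $\mathcal V(h)\subseteq[n]$ (possibly empty), with real weights $w_h$; the associated polynomial is $f(x)=\sum_{h\in\mathcal H}w_h\prod_{v\in \mathcal V(h)}x_v$. Its power $q$ is the maximum cardinality $|\mathcal V(h)|$ of a hyperedge. For an integer $r\ge 0$, $$\mu_r(f,Y)=\max_{S\subseteq[n]:|S|=r}\ \sum_{h\in\mathcal H:\ \mathcal V(h)\supseteq S}|w_h|\prod_{v\in\mathcal V(h)\setminus S}\mathbb E[|Y_v|].$$ *)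

theory Defs
  imports "HOL-Probability.Probability"
begin

text \<open>
  The integrability conjuncts say that the expectations are finite, so that the Bochner
  integrals below are the actual moments. Beyond integrability of \<open>Z\<close> they restrict nothing:
  read with values in \<open>[0, \<infinity>]\<close>, the inequalities force finiteness of all absolute central
  moments by induction on \<open>i\<close>.
\<close>
definition central_moment_bounded :: "'a measure \<Rightarrow> ('a \<Rightarrow> real) \<Rightarrow> real \<Rightarrow> bool" where
  "central_moment_bounded M Z L \<longleftrightarrow>
     integrable M Z \<and>
     (\<forall>i\<ge>1.
        integrable M (\<lambda>\<omega>. \<bar>Z \<omega> - integral\<^sup>L M Z\<bar> ^ i) \<and>
        integral\<^sup>L M (\<lambda>\<omega>. \<bar>Z \<omega> - integral\<^sup>L M Z\<bar> ^ i)
          \<le> real i * L * integral\<^sup>L M (\<lambda>\<omega>. \<bar>Z \<omega> - integral\<^sup>L M Z\<bar> ^ (i - 1)))"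

text \<open>
  Hyperedges have pairwise distinct vertex sets, so a hyperedge is identified with its vertex
  set and a hypergraph on \<open>{1..n}\<close> is a set \<open>H \<subseteq> Pow {1..n}\<close>. The empty hyperedge is allowed;
  it contributes a constant term.
\<close>
definition multilinear_poly :: "nat set set \<Rightarrow> (nat set \<Rightarrow> real) \<Rightarrow> (nat \<Rightarrow> real) \<Rightarrow> real" where
  "multilinear_poly H w x = (\<Sum>h\<in>H. w h * (\<Prod>v\<in>h. x v))"

definition poly_power :: "nat set set \<Rightarrow> nat" where
  "poly_power H = Max (card ` H)"

text \<open>Meaningful for \<open>r \<le> n\<close>; otherwise there is no \<open>S\<close> to maximise over.\<close>
definition mu :: "'a measure \<Rightarrow> nat \<Rightarrow> nat set set \<Rightarrow> (nat set \<Rightarrow> real) \<Rightarrow> (nat \<Rightarrow> 'a \<Rightarrow> real)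
    \<Rightarrow> nat \<Rightarrow> real" where
  "mu M n H w Y r =
     (MAX S\<in>{S. S \<subseteq> {1..n} \<and> card S = r}.
        \<Sum>h\<in>{h \<in> H. S \<subseteq> h}. \<bar>w h\<bar> * (\<Prod>v\<in>h - S. integral\<^sup>L M (\<lambda>\<omega>. \<bar>Y v \<omega>\<bar>)))"

end

theory Submission
  imports Defs
begin

text \<open>
  The variance is a double sum of covariances of monomials. Writing \<open>m v\<close>, \<open>a v\<close>, \<open>V v\<close> for the
  mean, the absolute mean and the variance of \<open>Y v\<close>, independence turns the covariance of the
  monomials \<open>h\<close> and \<open>k\<close> into the product of the means over the symmetric difference times
  \<open>\<Prod>(m\<^sup>2 + V) - \<Prod>m\<^sup>2\<close> over \<open>h \<inter> k\<close>. This expands into a sum over nonempty \<open>S \<subseteq> h \<inter> k\<close>, and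
  the moment condition gives \<open>V v \<le> 2 L E\<bar>Y v - m v\<bar> \<le> 4 L a v\<close>. Summing over \<open>k\<close> with \<open>h\<close> and
  \<open>S\<close> fixed yields \<open>mu\<close> at \<open>card S\<close>, and then there are at most \<open>2 ^ q\<close> choices of \<open>S\<close> for each
  \<open>h\<close>. This proves the bound with the constant \<open>2 ^ q\<close>.
\<close>

section \<open>Moments of a single variable\<close>

lemma central_moment_bounded_square_integrable:
  assumes "prob_space M" "central_moment_bounded M Z L"
  shows "integrable M (\<lambda>\<omega>. (Z \<omega>)\<^sup>2)"
proof -
  interpret prob_space M by fact
  define m where "m = expectation Z"
  have [simp]: "integrable M Z" 
    using assms(2) by (simp add: central_moment_bounded_def)
  have "integrable M (\<lambda>\<omega>. \<bar>Z \<omega> - m\<bar> ^ i)" if "i \<ge> 1" for i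
    using assms(2) that unfolding central_moment_bounded_def m_def by blast
  \<comment> \<open>Only central moments are given, so \<open>Z\<close> squared is recovered from
    the central square plus an affine function of \<open>Z\<close>.\<close>
  from this[of 2] have "integrable M (\<lambda>\<omega>. (Z \<omega> - m)\<^sup>2 + (2 * m * Z \<omega> - m\<^sup>2))"
    by (intro Bochner_Integration.integrable_add Bochner_Integration.integrable_diff
        integrable_mult_right) simp_all
  then show ?thesis
    by (simp add: power2_diff algebra_simps)
qed

text \<open>The condition at \<open>i = 2\<close> gives \<open>2 * L\<close> times the mean absolute
  deviation; the triangle inequality and |E Z| \<le> E|Z| cost another factor 2. The absolute mean
  is the target because it is the quantity from which \<open>mu\<close> is built.\<close>

lemma central_moment_bounded_variance_le:
  assumes "prob_space M" "central_moment_bounded M Z L" "L > 0"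
  shows "prob_space.variance M Z \<le> 4 * L * (\<integral>\<omega>. \<bar>Z \<omega>\<bar> \<partial>M)"
proof -
  interpret prob_space M by fact
  define m where "m = expectation Z"
  have [simp]: "integrable M Z" 
    using assms(2) by (simp add: central_moment_bounded_def)
  have "expectation (\<lambda>\<omega>. \<bar>Z \<omega> - m\<bar> ^ i)
          \<le> real i * L * expectation (\<lambda>\<omega>. \<bar>Z \<omega> - m\<bar> ^ (i - 1))" if "i \<ge> 1" for i
    using assms(2) that unfolding central_moment_bounded_def m_def by blast
  from this[of 2] have "variance Z \<le> 2 * L * expectation (\<lambda>\<omega>. \<bar>Z \<omega> - m\<bar>)"
    by (simp add: m_def)
  also have "expectation (\<lambda>\<omega>. \<bar>Z \<omega> - m\<bar>) \<le> expectation (\<lambda>\<omega>. \<bar>Z \<omega>\<bar> + \<bar>m\<bar>)"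
    by (intro integral_mono) auto
  also have "\<dots> = expectation (\<lambda>\<omega>. \<bar>Z \<omega>\<bar>) + \<bar>m\<bar>"
    by (simp add: prob_space)
  also have "\<bar>m\<bar> \<le> expectation (\<lambda>\<omega>. \<bar>Z \<omega>\<bar>)"
    unfolding m_def by (rule integral_abs_bound)
  finally show ?thesis
    using \<open>L > 0\<close> by (simp add: mult_left_mono)
qed

section \<open>Expansion of a product of second moments\<close>

text \<open>In the expansion over subsets \<open>S\<close> of \<open>C\<close>, the term
  \<open>S = {}\<close> is exactly the subtracted product. In every other term each \<open>v\<close>
  in \<open>S\<close> contributes \<open>K * a v\<close> and each \<open>v\<close> outside
  contributes \<open>a v\<close> twice. One copy of \<open>a\<close> is collected over all of
  \<open>C\<close>, the other over \<open>C - S\<close>; the first will belong to one monomial and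
  the second to the other.\<close>

lemma prod_add_diff_abs_le:
  fixes m V a :: "'i \<Rightarrow> real"
  assumes "finite C" and V: "\<And>v. v \<in> C \<Longrightarrow> 0 \<le> V v \<and> V v \<le> K * a v"
    and m: "\<And>v. v \<in> C \<Longrightarrow> \<bar>m v\<bar> \<le> a v"
  shows "\<bar>(\<Prod>v\<in>C. V v + (m v)\<^sup>2) - (\<Prod>v\<in>C. (m v)\<^sup>2)\<bar>
    \<le> (\<Sum>S\<in>Pow C - {{}}. K ^ card S * (prod a C * prod a (C - S)))"
proof -
  have "(\<Prod>v\<in>C. V v + (m v)\<^sup>2) - (\<Prod>v\<in>C. (m v)\<^sup>2)
      = (\<Sum>S\<in>Pow C - {{}}. prod V S * (\<Prod>v\<in>C - S. (m v)\<^sup>2))"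
    using \<open>finite C\<close> by (simp add: prod_add sum_diff1)
  also have "\<bar>\<dots>\<bar> \<le> (\<Sum>S\<in>Pow C - {{}}. K ^ card S * (prod a C * prod a (C - S)))"
  proof (rule order.trans[OF sum_abs sum_mono])
    fix S assume S: "S \<in> Pow C - {{}}"
    have a: "0 \<le> a v" if "v \<in> C" for v
      using m[OF that] by simp
    \<comment> \<open>\<open>K\<close> carries no sign assumption here; nonnegativity of the product
      comes from the two-sided bound on \<open>V v\<close>.\<close>
    have Ka: "0 \<le> K * a v" if "v \<in> C" for v
      using V[OF that] by linarith
    have "prod V S * (\<Prod>v\<in>C - S. (m v)\<^sup>2) \<le> (\<Prod>v\<in>S. K * a v) * (\<Prod>v\<in>C - S. (a v)\<^sup>2)"
      using S V m a Ka
      by (intro mult_mono prod_mono prod_nonneg conjI)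
        (auto simp: abs_le_square_iff[symmetric])
    also have "\<dots> = K ^ card S * ((prod a S * prod a (C - S)) * prod a (C - S))"
      by (simp add: prod.distrib power2_eq_square)
    also have "prod a S * prod a (C - S) = prod a C"
      using S \<open>finite C\<close> prod.subset_diff[of S C a] by (simp add: mult.commute)
    finally show "\<bar>prod V S * (\<Prod>v\<in>C - S. (m v)\<^sup>2)\<bar>
        \<le> K ^ card S * (prod a C * prod a (C - S))"
      using S V by (subst abs_of_nonneg) (auto intro!: mult_nonneg_nonneg prod_nonneg)
  qed
  finally show ?thesis .
qed

section \<open>Independence and covariances of monomials\<close>

context prob_space
begin

text \<open>The two monomials share variables, so independence does not apply to their product
  directly. Merging each repeated variable into a square gives a product over
  \<open>h \<union> k\<close> in which every index occurs once, and this is a product of independent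
  factors.\<close>

lemma
  fixes Y :: "'i \<Rightarrow> 'a \<Rightarrow> real"
  assumes indep: "indep_vars (\<lambda>_. borel) Y I"
    and int: "\<And>v. v \<in> I \<Longrightarrow> integrable M (Y v)"
    and int2: "\<And>v. v \<in> I \<Longrightarrow> integrable M (\<lambda>\<omega>. (Y v \<omega>)\<^sup>2)"
    and hk: "h \<subseteq> I" "k \<subseteq> I" and fin: "finite h" "finite k"
  shows integrable_monomial_mult: "integrable M (\<lambda>\<omega>. (\<Prod>v\<in>h. Y v \<omega>) * (\<Prod>v\<in>k. Y v \<omega>))"
    and expectation_monomial_mult: "expectation (\<lambda>\<omega>. (\<Prod>v\<in>h. Y v \<omega>) * (\<Prod>v\<in>k. Y v \<omega>))
      = (\<Prod>v\<in>h - k. expectation (Y v)) * (\<Prod>v\<in>k - h. expectation (Y v))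
        * (\<Prod>v\<in>h \<inter> k. expectation (\<lambda>\<omega>. (Y v \<omega>)\<^sup>2))"
proof -
  define g :: "'i \<Rightarrow> real \<Rightarrow> real" where "g v x = (if v \<in> h \<inter> k then x\<^sup>2 else x)" for v x
  have [measurable]: "g v \<in> borel_measurable borel" for v
    unfolding g_def by (cases "v \<in> h \<inter> k") simp_all
  have ind: "indep_vars (\<lambda>_. borel) (\<lambda>v \<omega>. g v (Y v \<omega>)) (h \<union> k)"
  proof (rule indep_vars_compose2[where X = Y and Y = g])
    show "indep_vars (\<lambda>_. borel) Y (h \<union> k)"
      using hk by (intro indep_vars_subset[OF indep]) auto
  qed simp
  have g_int: "integrable M (\<lambda>\<omega>. g v (Y v \<omega>))" if "v \<in> h \<union> k" for v
    using that hk int[of v] int2[of v] by (cases "v \<in> h \<inter> k") (auto simp: g_def)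
  have split: "(\<Prod>v\<in>h \<union> k. f v) = (\<Prod>v\<in>h - k. f v) * (\<Prod>v\<in>k - h. f v) * (\<Prod>v\<in>h \<inter> k. f v)"
    for f :: "'i \<Rightarrow> real"
  proof -
    have "h \<union> k = ((h - k) \<union> (k - h)) \<union> (h \<inter> k)" by blast
    then have "(\<Prod>v\<in>h \<union> k. f v) = (\<Prod>v\<in>((h - k) \<union> (k - h)) \<union> (h \<inter> k). f v)" by simp
    also have "\<dots> = (\<Prod>v\<in>(h - k) \<union> (k - h). f v) * (\<Prod>v\<in>h \<inter> k. f v)"
      using fin by (intro prod.union_disjoint) auto
    also have "(\<Prod>v\<in>(h - k) \<union> (k - h). f v) = (\<Prod>v\<in>h - k. f v) * (\<Prod>v\<in>k - h. f v)"
      using fin by (intro prod.union_disjoint) auto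
    finally show ?thesis .
  qed
  have prod_g: "(\<Prod>v\<in>h. Y v \<omega>) * (\<Prod>v\<in>k. Y v \<omega>) = (\<Prod>v\<in>h \<union> k. g v (Y v \<omega>))" for \<omega>
    unfolding split prod.Int_Diff[OF fin(1), of _ k] prod.Int_Diff[OF fin(2), of _ h]
    by (simp add: g_def power2_eq_square prod.distrib Int_commute)
  show "integrable M (\<lambda>\<omega>. (\<Prod>v\<in>h. Y v \<omega>) * (\<Prod>v\<in>k. Y v \<omega>))"
    unfolding prod_g using fin g_int ind by (intro indep_vars_integrable) auto
  have "expectation (\<lambda>\<omega>. (\<Prod>v\<in>h. Y v \<omega>) * (\<Prod>v\<in>k. Y v \<omega>))
      = (\<Prod>v\<in>h \<union> k. expectation (\<lambda>\<omega>. g v (Y v \<omega>)))"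
    unfolding prod_g using fin g_int ind by (intro indep_vars_lebesgue_integral) auto
  also have "\<dots> = (\<Prod>v\<in>h - k. expectation (Y v)) * (\<Prod>v\<in>k - h. expectation (Y v))
        * (\<Prod>v\<in>h \<inter> k. expectation (\<lambda>\<omega>. (Y v \<omega>)\<^sup>2))"
    unfolding split by (simp add: g_def)
  finally show "expectation (\<lambda>\<omega>. (\<Prod>v\<in>h. Y v \<omega>) * (\<Prod>v\<in>k. Y v \<omega>)) = \<dots>" .
qed

text \<open>The bound is deliberately asymmetric in \<open>h\<close> and \<open>k\<close>: the full
  product over \<open>h\<close> will sum to \<open>mu\<close> at 0, while the product over
  \<open>k - S\<close> is the summand of \<open>mu\<close> at \<open>card S\<close>.\<close>

lemma monomial_covariance_le:
  fixes Y :: "'i \<Rightarrow> 'a \<Rightarrow> real"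
  defines "a \<equiv> \<lambda>v. expectation (\<lambda>\<omega>. \<bar>Y v \<omega>\<bar>)"
  assumes indep: "indep_vars (\<lambda>_. borel) Y I"
    and int: "\<And>v. v \<in> I \<Longrightarrow> integrable M (Y v)"
    and int2: "\<And>v. v \<in> I \<Longrightarrow> integrable M (\<lambda>\<omega>. (Y v \<omega>)\<^sup>2)"
    and var: "\<And>v. v \<in> I \<Longrightarrow> variance (Y v) \<le> K * a v"
    and hk: "h \<subseteq> I" "k \<subseteq> I" and fin: "finite h" "finite k"
  shows "\<bar>expectation (\<lambda>\<omega>. (\<Prod>v\<in>h. Y v \<omega>) * (\<Prod>v\<in>k. Y v \<omega>))
      - (\<Prod>v\<in>h. expectation (Y v)) * (\<Prod>v\<in>k. expectation (Y v))\<bar>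
    \<le> (\<Sum>S\<in>Pow (h \<inter> k) - {{}}. K ^ card S * (prod a h * prod a (k - S)))"
proof -
  define m where "m v = expectation (Y v)" for v
  define V where "V v = variance (Y v)" for v
  have m: "\<bar>m v\<bar> \<le> a v" for v
    unfolding m_def a_def by (rule integral_abs_bound)
  have a: "0 \<le> a v" for v
    unfolding a_def by simp
  have sq: "expectation (\<lambda>\<omega>. (Y v \<omega>)\<^sup>2) = V v + (m v)\<^sup>2" if "v \<in> I" for v
    unfolding V_def m_def using variance_eq[OF int[OF that] int2[OF that]] by simp
  let ?D = "(\<Prod>v\<in>h \<inter> k. V v + (m v)\<^sup>2) - (\<Prod>v\<in>h \<inter> k. (m v)\<^sup>2)"
  have "expectation (\<lambda>\<omega>. (\<Prod>v\<in>h. Y v \<omega>) * (\<Prod>v\<in>k. Y v \<omega>))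
      = prod m (h - k) * prod m (k - h) * (\<Prod>v\<in>h \<inter> k. V v + (m v)\<^sup>2)"
    using hk by (subst expectation_monomial_mult[OF indep int int2 hk fin])
      (auto simp: m_def[symmetric] intro!: prod.cong sq)
  moreover have "prod m h * prod m k = prod m (h - k) * prod m (k - h) * (\<Prod>v\<in>h \<inter> k. (m v)\<^sup>2)"
    unfolding prod.Int_Diff[OF fin(1), of _ k] prod.Int_Diff[OF fin(2), of _ h]
    by (simp add: power2_eq_square prod.distrib Int_commute)
  \<comment> \<open>The means over both set differences are a common factor of the mixed moment and
    the product of means, so only the common vertices produce a difference.\<close>
  ultimately have "\<bar>expectation (\<lambda>\<omega>. (\<Prod>v\<in>h. Y v \<omega>) * (\<Prod>v\<in>k. Y v \<omega>)) - prod m h * prod m k\<bar>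
      = (\<Prod>v\<in>h - k. \<bar>m v\<bar>) * (\<Prod>v\<in>k - h. \<bar>m v\<bar>) * \<bar>?D\<bar>"
    by (simp add: right_diff_distrib[symmetric] abs_mult abs_prod)
  also have "\<dots> \<le> prod a (h - k) * prod a (k - h)
      * (\<Sum>S\<in>Pow (h \<inter> k) - {{}}. K ^ card S * (prod a (h \<inter> k) * prod a (h \<inter> k - S)))"
  proof (intro mult_mono prod_mono prod_add_diff_abs_le)
    show "0 \<le> V v \<and> V v \<le> K * a v" if "v \<in> h \<inter> k" for v
      using that hk var[of v] unfolding V_def by (auto simp: variance_positive)
  qed (use fin m a in \<open>auto intro!: mult_nonneg_nonneg prod_nonneg\<close>)
  also have "\<dots> = (\<Sum>S\<in>Pow (h \<inter> k) - {{}}. K ^ card S * (prod a h * prod a (k - S)))"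
    unfolding sum_distrib_left
  proof (rule sum.cong[OF refl])
    fix S assume S: "S \<in> Pow (h \<inter> k) - {{}}"
    have "prod a h = prod a (h \<inter> k) * prod a (h - k)"
      using fin by (simp add: prod.Int_Diff)
    \<comment> \<open>\<open>S\<close> lies in \<open>h \<inter> k\<close>, so removing it from
      \<open>k\<close> leaves \<open>k - h\<close> untouched.\<close>
    moreover have "prod a (k - S) = prod a (h \<inter> k - S) * prod a (k - h)"
    proof -
      have "(k - S) \<inter> h = h \<inter> k - S" "(k - S) - h = k - h" using S by auto
      then show ?thesis using fin prod.Int_Diff[of "k - S" a h] by simp
    qed
    ultimately show "prod a (h - k) * prod a (k - h)
        * (K ^ card S * (prod a (h \<inter> k) * prod a (h \<inter> k - S)))
      = K ^ card S * (prod a h * prod a (k - S))"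
      by (simp add: mult_ac)
  qed
  finally show ?thesis
    unfolding m_def .
qed

text \<open>Bilinearity of the covariance, with the mean of each monomial factored by independence.
  Square integrability of the polynomial comes from that of products of two monomials.\<close>

lemma variance_multilinear_poly_eq:
  fixes Y :: "nat \<Rightarrow> 'a \<Rightarrow> real"
  assumes indep: "indep_vars (\<lambda>_. borel) Y I"
    and int: "\<And>v. v \<in> I \<Longrightarrow> integrable M (Y v)"
    and int2: "\<And>v. v \<in> I \<Longrightarrow> integrable M (\<lambda>\<omega>. (Y v \<omega>)\<^sup>2)"
    and "finite I" "H \<subseteq> Pow I"
  shows "variance (\<lambda>\<omega>. multilinear_poly H w (\<lambda>v. Y v \<omega>))
    = (\<Sum>h\<in>H. \<Sum>k\<in>H. w h * w k *
        (expectation (\<lambda>\<omega>. (\<Prod>v\<in>h. Y v \<omega>) * (\<Prod>v\<in>k. Y v \<omega>))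
          - (\<Prod>v\<in>h. expectation (Y v)) * (\<Prod>v\<in>k. expectation (Y v))))"
proof -
  define X where "X h \<omega> = (\<Prod>v\<in>h. Y v \<omega>)" for h \<omega>
  let ?f = "\<lambda>\<omega>. multilinear_poly H w (\<lambda>v. Y v \<omega>)"
  have H: "h \<subseteq> I" "finite h" if "h \<in> H" for h
    using that assms(4,5) finite_subset by blast+
  have X_mult_int: "integrable M (\<lambda>\<omega>. X h \<omega> * X k \<omega>)" if "h \<in> H" "k \<in> H" for h k
    unfolding X_def using that H by (intro integrable_monomial_mult[OF indep int int2]) auto
  have X_int: "integrable M (X h)" and X_exp: "expectation (X h) = (\<Prod>v\<in>h. expectation (Y v))"
    if "h \<in> H" for h
    unfolding X_def[abs_def] using H[OF that] int indep_vars_subset[OF indep, of h]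
    by (intro indep_vars_integrable indep_vars_lebesgue_integral; auto)+
  have f: "?f \<omega> = (\<Sum>h\<in>H. w h * X h \<omega>)" for \<omega>
    by (simp add: multilinear_poly_def X_def)
  have f2: "(?f \<omega>)\<^sup>2 = (\<Sum>h\<in>H. \<Sum>k\<in>H. w h * w k * (X h \<omega> * X k \<omega>))" for \<omega>
    by (simp add: f power2_eq_square sum_product mult_ac)
  have "variance ?f = expectation (\<lambda>\<omega>. (?f \<omega>)\<^sup>2) - (expectation ?f)\<^sup>2"
  proof (rule variance_eq)
    show "integrable M ?f"
      unfolding f using X_int by simp
    show "integrable M (\<lambda>\<omega>. (?f \<omega>)\<^sup>2)"
      unfolding f2 using X_mult_int by simp
  qed
  also have "expectation (\<lambda>\<omega>. (?f \<omega>)\<^sup>2)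
      = (\<Sum>h\<in>H. \<Sum>k\<in>H. w h * w k * expectation (\<lambda>\<omega>. X h \<omega> * X k \<omega>))"
    unfolding f2 by (simp add: X_mult_int Bochner_Integration.integral_sum)
  also have "(expectation ?f)\<^sup>2 = (\<Sum>h\<in>H. w h * (\<Prod>v\<in>h. expectation (Y v)))\<^sup>2"
    unfolding f by (simp add: X_int X_exp Bochner_Integration.integral_sum)
  finally show ?thesis
    by (simp only: X_def power2_eq_square sum_product sum_subtractf[symmetric]
        right_diff_distrib mult_ac)
qed

end

section \<open>Properties of \<open>mu\<close> and a count of subsets\<close>

lemma mu_ge:
  assumes "S \<subseteq> {1..n}"
  shows "(\<Sum>h\<in>{h \<in> H. S \<subseteq> h}. \<bar>w h\<bar> * (\<Prod>v\<in>h - S. integral\<^sup>L M (\<lambda>\<omega>. \<bar>Y v \<omega>\<bar>)))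
    \<le> mu M n H w Y (card S)"
  unfolding mu_def using assms by (intro Max_ge) (auto intro: finite_subset[of _ "Pow {1..n}"])

lemma mu_zero: "mu M n H w Y 0 = (\<Sum>h\<in>H. \<bar>w h\<bar> * (\<Prod>v\<in>h. integral\<^sup>L M (\<lambda>\<omega>. \<bar>Y v \<omega>\<bar>)))"
proof -
  \<comment> \<open>Infinite sets also have \<open>card\<close> 0; being contained in
    \<open>{1..n}\<close> excludes them.\<close>
  have "{S. S \<subseteq> {1..n} \<and> card S = 0} = {{}}"
    by (auto simp: card_eq_0_iff dest: finite_subset)
  then show ?thesis
    unfolding mu_def by simp
qed

lemma sum_nonempty_subsets_le:
  fixes b :: real
  assumes "finite h" "card h \<le> q" "0 \<le> b"
    and "\<And>S. S \<subseteq> h \<Longrightarrow> S \<noteq> {} \<Longrightarrow> f S \<le> b"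
  shows "(\<Sum>S\<in>Pow h - {{}}. f S) \<le> 2 ^ q * b"
proof -
  have "(\<Sum>S\<in>Pow h - {{}}. f S) \<le> of_nat (card (Pow h - {{}})) * b"
    using assms(4) by (intro sum_bounded_above) auto
  also have "card (Pow h - {{}}) \<le> 2 ^ q"
  proof -
    have "card (Pow h - {{}}) \<le> card (Pow h)"
      using assms(1) by (intro card_mono) auto
    also have "\<dots> \<le> 2 ^ q"
      using assms(1,2) by (simp add: card_Pow)
    finally show ?thesis .
  qed
  finally show ?thesis
    using \<open>0 \<le> b\<close> by (simp add: mult_right_mono)
qed

section \<open>Summation over pairs of hyperedges\<close>

theorem lemma1p5:
  fixes M :: "'a measure" and Y :: "nat \<Rightarrow> 'a \<Rightarrow> real"
    and H :: "nat set set" and w :: "nat set \<Rightarrow> real"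
    and n q :: nat and L :: real
  assumes "prob_space M"
    and "n \<ge> 1" and "q \<ge> 1" and "L > 0"
    and "prob_space.indep_vars M (\<lambda>_. borel) Y {1..n}"
    and "\<And>v. v \<in> {1..n} \<Longrightarrow> central_moment_bounded M (Y v) L"
    and "H \<subseteq> Pow {1..n}"
    and "H \<noteq> {}"
    and "poly_power H = q"
  shows "prob_space.variance M (\<lambda>\<omega>. multilinear_poly H w (\<lambda>v. Y v \<omega>))
    \<le> 2 * real q * 4 ^ q *
       (MAX r\<in>{1..q}. mu M n H w Y 0 * mu M n H w Y r * 4 ^ r * L ^ r)"
proof -
  interpret prob_space M by fact
  define K where "K = 4 * L"
  define a where "a v = expectation (\<lambda>\<omega>. \<bar>Y v \<omega>\<bar>)" for v
  let ?\<mu> = "mu M n H w Y"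
  \<comment> \<open>The maximum from the goal without the factor \<open>mu\<close> at 0, which does
    not depend on \<open>r\<close> and arises only in the final sum over \<open>h\<close>.\<close>
  define D where "D = (MAX r\<in>{1..q}. K ^ r * ?\<mu> r)"
  let ?B = "MAX r\<in>{1..q}. ?\<mu> 0 * ?\<mu> r * 4 ^ r * L ^ r"
  have finH: "finite H"
    using assms(7) finite_subset by blast
  have fin: "finite h" and sub: "h \<subseteq> {1..n}" if "h \<in> H" for h
    using that assms(7) finite_subset by blast+
  have card: "card h \<le> q" if "h \<in> H" for h
    using that finH assms(9) unfolding poly_power_def by (metis Max_ge finite_imageI imageI)
  have K: "0 \<le> K" and a: "0 \<le> a v" for v
    using assms(4) by (simp_all add: K_def a_def)
  have mu_ge_a: "(\<Sum>k\<in>{k \<in> H. S \<subseteq> k}. \<bar>w k\<bar> * prod a (k - S)) \<le> ?\<mu> (card S)"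
    if "S \<subseteq> {1..n}" for S
    using mu_ge[OF that] unfolding a_def .
  have mu0: "?\<mu> 0 = (\<Sum>h\<in>H. \<bar>w h\<bar> * prod a h)"
    unfolding mu_zero a_def ..
  have mu0_nonneg: "0 \<le> ?\<mu> 0"
    unfolding mu0 by (intro sum_nonneg mult_nonneg_nonneg prod_nonneg) (auto simp: a)
  have D: "K ^ r * ?\<mu> r \<le> D" if "r \<in> {1..q}" for r
    unfolding D_def using that by (intro Max_ge) auto
  \<comment> \<open>One nonnegative candidate suffices. A hyperedge of maximal size \<open>q\<close>
    is an admissible set for \<open>mu\<close> at \<open>q\<close>, and its sum is
    nonnegative.\<close>
  have D_nonneg: "0 \<le> D"
  proof -
    have "q \<in> card ` H"
      unfolding assms(9)[symmetric] poly_power_def using finH assms(8) by (intro Max_in) auto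
    then obtain h where h: "h \<in> H" "card h = q"
      by blast
    have "0 \<le> (\<Sum>k\<in>{k \<in> H. h \<subseteq> k}. \<bar>w k\<bar> * prod a (k - h))"
      by (intro sum_nonneg mult_nonneg_nonneg prod_nonneg) (auto simp: a)
    then have "0 \<le> ?\<mu> q"
      using mu_ge_a[OF sub[OF h(1)]] h(2) by simp
    then show ?thesis
      using D[of q] assms(3) K by (auto intro: order.trans[rotated])
  qed
  have cov: "\<bar>expectation (\<lambda>\<omega>. (\<Prod>v\<in>h. Y v \<omega>) * (\<Prod>v\<in>k. Y v \<omega>))
        - (\<Prod>v\<in>h. expectation (Y v)) * (\<Prod>v\<in>k. expectation (Y v))\<bar>
      \<le> (\<Sum>S\<in>Pow (h \<inter> k) - {{}}. K ^ card S * (prod a h * prod a (k - S)))"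
    (is "\<bar>?cov h k\<bar> \<le> _") if "h \<in> H" "k \<in> H" for h k
    unfolding a_def
  proof (rule monomial_covariance_le[OF assms(5)])
    show "integrable M (Y v)" if "v \<in> {1..n}" for v
      using assms(6)[OF that] by (simp add: central_moment_bounded_def)
    show "integrable M (\<lambda>\<omega>. (Y v \<omega>)\<^sup>2)" if "v \<in> {1..n}" for v
      using assms(6)[OF that] assms(1) central_moment_bounded_square_integrable by blast
    show "variance (Y v) \<le> K * expectation (\<lambda>\<omega>. \<bar>Y v \<omega>\<bar>)" if "v \<in> {1..n}" for v
      unfolding K_def using central_moment_bounded_variance_le[OF assms(1) assms(6)[OF that] assms(4)] .
  qed (use that sub fin in auto)
  \<comment> \<open>The contribution of all \<open>k\<close> for a fixed \<open>h\<close>. Summing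
    over \<open>k\<close> inside and over \<open>S\<close> outside makes the inner sum the one that
    \<open>mu\<close> maximises.\<close>
  have row: "(\<Sum>k\<in>H. \<bar>w k\<bar> * (\<Sum>S\<in>Pow (h \<inter> k) - {{}}. K ^ card S * (prod a h * prod a (k - S))))
      \<le> prod a h * (2 ^ q * D)" if h: "h \<in> H" for h
  proof -
    have "(\<Sum>k\<in>H. \<bar>w k\<bar> * (\<Sum>S\<in>Pow (h \<inter> k) - {{}}. K ^ card S * (prod a h * prod a (k - S))))
        = (\<Sum>k\<in>H. \<Sum>S\<in>{S \<in> Pow h - {{}}. S \<subseteq> k}.
            prod a h * (K ^ card S * (\<bar>w k\<bar> * prod a (k - S))))"
      unfolding sum_distrib_left by (intro sum.cong) (auto simp: mult_ac)
    also have "\<dots> = (\<Sum>S\<in>Pow h - {{}}. \<Sum>k\<in>{k \<in> H. S \<subseteq> k}.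
            prod a h * (K ^ card S * (\<bar>w k\<bar> * prod a (k - S))))"
      using finH fin[OF h] by (intro sum.swap_restrict) auto
    also have "\<dots> = prod a h * (\<Sum>S\<in>Pow h - {{}}. 
            K ^ card S * (\<Sum>k\<in>{k \<in> H. S \<subseteq> k}. \<bar>w k\<bar> * prod a (k - S)))"
      by (simp add: sum_distrib_left)
    also have "\<dots> \<le> prod a h * (2 ^ q * D)"
    proof (intro mult_left_mono sum_nonempty_subsets_le)
      fix S assume S: "S \<subseteq> h" "S \<noteq> {}"
      have "K ^ card S * (\<Sum>k\<in>{k \<in> H. S \<subseteq> k}. \<bar>w k\<bar> * prod a (k - S)) \<le> K ^ card S * ?\<mu> (card S)"
        using S sub[OF h] K by (intro mult_left_mono mu_ge_a) auto
      also have "\<dots> \<le> D"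
      proof (rule D)
        \<comment> \<open>\<open>S\<close> is nonempty and lies in a hyperedge, which is why the
          maximum may run from 1 to \<open>q\<close> only.\<close>
        have "card S \<le> q"
          using card_mono[OF fin[OF h] S(1)] card[OF h] by simp
        moreover have "card S \<noteq> 0"
          using S finite_subset[OF S(1) fin[OF h]] by simp
        ultimately show "card S \<in> {1..q}" by simp
      qed
      finally show "K ^ card S * (\<Sum>k\<in>{k \<in> H. S \<subseteq> k}. \<bar>w k\<bar> * prod a (k - S)) \<le> D" .
    qed (use fin[OF h] card[OF h] D_nonneg a in \<open>auto intro: prod_nonneg\<close>)
    finally show ?thesis .
  qed
  have "variance (\<lambda>\<omega>. multilinear_poly H w (\<lambda>v. Y v \<omega>)) = (\<Sum>h\<in>H. \<Sum>k\<in>H. w h * w k * ?cov h k)"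
  proof (rule variance_multilinear_poly_eq[OF assms(5)])
    show "integrable M (Y v)" if "v \<in> {1..n}" for v
      using assms(6)[OF that] by (simp add: central_moment_bounded_def)
    show "integrable M (\<lambda>\<omega>. (Y v \<omega>)\<^sup>2)" if "v \<in> {1..n}" for v
      using assms(6)[OF that] assms(1) central_moment_bounded_square_integrable by blast
  qed (use assms(7) in auto)
  also have "\<dots> \<le> (\<Sum>h\<in>H. \<Sum>k\<in>H. \<bar>w h\<bar> * (\<bar>w k\<bar>
      * (\<Sum>S\<in>Pow (h \<inter> k) - {{}}. K ^ card S * (prod a h * prod a (k - S)))))"
  proof (intro sum_mono)
    fix h k assume hk: "h \<in> H" "k \<in> H"
    \<comment> \<open>Weights and covariances may have either sign; absolute values produce the
      unsigned weights used in \<open>mu\<close>.\<close>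
    have "w h * w k * ?cov h k \<le> \<bar>w h\<bar> * (\<bar>w k\<bar> * \<bar>?cov h k\<bar>)"
      by (rule order.trans[OF abs_ge_self]) (simp only: abs_mult mult.assoc order.refl)
    also have "\<dots> \<le> \<bar>w h\<bar> * (\<bar>w k\<bar>
        * (\<Sum>S\<in>Pow (h \<inter> k) - {{}}. K ^ card S * (prod a h * prod a (k - S))))"
      by (intro mult_left_mono cov[OF hk] abs_ge_zero)
    finally show "w h * w k * ?cov h k \<le> \<dots>" .
  qed
  also have "\<dots> \<le> (\<Sum>h\<in>H. \<bar>w h\<bar> * (prod a h * (2 ^ q * D)))"
    unfolding sum_distrib_left[symmetric] by (intro sum_mono mult_left_mono row abs_ge_zero)
  also have "\<dots> = 2 ^ q * (?\<mu> 0 * D)"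
    by (simp add: mu0 sum_distrib_left sum_distrib_right mult_ac)
  \<comment> \<open>The factor \<open>2 ^ q\<close> is relaxed to the stated constant. Since
    \<open>K = 4 * L\<close>, the index attaining \<open>D\<close> gives, after multiplication by
    \<open>mu\<close> at 0, one of the terms under the maximum \<open>?B\<close>.\<close>
  also have "\<dots> \<le> (2 * real q * 4 ^ q) * ?B"
  proof (intro mult_mono)
    have "(2::real) ^ q \<le> 4 ^ q"
      by (intro power_mono) auto
    also have "\<dots> \<le> (2 * real q) * 4 ^ q"
      using assms(3) by simp
    finally show "(2::real) ^ q \<le> 2 * real q * 4 ^ q" .
    have "D \<in> (\<lambda>r. K ^ r * ?\<mu> r) ` {1..q}"
      unfolding D_def using assms(3) by (intro Max_in) auto
    then obtain r where r: "r \<in> {1..q}" "D = K ^ r * ?\<mu> r"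
      by blast
    have "?\<mu> 0 * D = ?\<mu> 0 * ?\<mu> r * 4 ^ r * L ^ r"
      by (simp add: r(2) K_def power_mult_distrib)
    also have "\<dots> \<le> ?B"
      using r(1) by (intro Max_ge) auto
    finally show "?\<mu> 0 * D \<le> ?B" .
  qed (use mu0_nonneg D_nonneg in auto)
  finally show ?thesis .
qed

end
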